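(* Let $n\ge3$. The connection Laplacian $L$ of the circular graph $C_n$ is a $2n\times2n$ matrix whose eigenvalues, counted with multiplicity, are $f^{+}(\mu_k)$ and $f^{-}(\mu_k)$ for $k=1,\dots,n$, where $$\mu_k=4\cos^2\Big(\frac{\pi k}{n}\Big),\qquad f^{\pm}(x)=\frac{x\pm\sqrt{x^2+4}}{2}.$$
   Context: The circular graph $C_n$ is regarded as the $1$-dimensional simplicial complex consisting of the $n$ vertices $\{1\},\dots,\{n\}$ and the $n$ edges $\{1,2\},\{2,3\},\dots,\{n-1,n\},\{n,1\}$. Its connection Laplacian $L$ is the matrix indexed by these $2n$ simplices with $L(x,y)=1$ if $x\cap y\neq\emptyset$ and $0$ otherwise. *)

theory Defs
  imports Complex_Main "Jordan_Normal_Form.Char_Poly"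
begin

definition circular_graph :: "nat \<Rightarrow> nat set set" where
  "circular_graph n =
     {{i} | i. i \<in> {1..n}} \<union> {{i, i + 1} | i. i \<in> {1..<n}} \<union> {{n, 1}}"

text \<open>The matrix is indexed by positions in an enumeration \<open>xs\<close> of the simplices
  (each simplex being the set of its vertices).\<close>

definition connection_Laplacian :: "'a set list \<Rightarrow> real mat" where
  "connection_Laplacian xs =
     mat (length xs) (length xs) (\<lambda>(i, j). if xs ! i \<inter> xs ! j \<noteq> {} then 1 else 0)"

text \<open>Multiplicity is algebraic multiplicity.  Only eigenvalues in the field \<open>'a\<close> are
  listed, so the multiset has as many elements as the matrix has rows exactly when the
  characteristic polynomial splits over \<open>'a\<close>.\<close>

definition eigenvalues_mset :: "'a :: field mat \<Rightarrow> 'a multiset" where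
  "eigenvalues_mset A = proots (char_poly A)"

lemma count_eigenvalues_mset:
  assumes "A \<in> carrier_mat m m"
  shows "count (eigenvalues_mset A) x = order x (char_poly A)"
proof -
  have "char_poly A \<noteq> 0"
    using degree_monic_char_poly[OF assms] by auto
  then show ?thesis
    by (simp add: eigenvalues_mset_def)
qed

lemma set_mset_eigenvalues_mset:
  assumes "A \<in> carrier_mat m m"
  shows "set_mset (eigenvalues_mset A) = {x. eigenvalue A x}"
proof -
  have "char_poly A \<noteq> 0"
    using degree_monic_char_poly[OF assms] by auto
  then show ?thesis
    by (simp add: eigenvalues_mset_def eigenvalue_root_char_poly[OF assms])
qed

definition mu :: "nat \<Rightarrow> nat \<Rightarrow> real" where
  "mu n k = 4 * (cos (pi * real k / real n))\<^sup>2"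

definition f_plus :: "real \<Rightarrow> real" where
  "f_plus x = (x + sqrt (x\<^sup>2 + 4)) / 2"

definition f_minus :: "real \<Rightarrow> real" where
  "f_minus x = (x - sqrt (x\<^sup>2 + 4)) / 2"

end

theory Submission
  imports Defs
begin

text \<open>Order the vertices and edges of the circle alternately: the vertex \<open>i\<close> sits at position
  \<open>i\<close> and the edge from \<open>i\<close> to its successor at the midpoint \<open>i + 1/2\<close>.  The Laplacian commutes with
  rotations, so plane waves sampled at these positions reduce it to \<open>2 \<times> 2\<close> blocks.  With
  \<open>h(x)\<close> a wave of angular frequency \<open>2 \<pi> k / n\<close> one has \<open>h(x - 1/2) + h(x + 1/2) = b h(x)\<close> where
  \<open>b = 2 cos (\<pi> k / n)\<close>, hence \<open>b\<^sup>2 = \<mu>\<^sub>k\<close>.  A vertex meets itself and its two edges; an edge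
  meets its two end points, itself and its two neighbours.  On functions equal to \<open>\<alpha> h\<close> on vertices
  and \<open>\<beta> h\<close> on edges, the Laplacian therefore acts by the symmetric matrix with rows
  \<open>(1, b)\<close> and \<open>(b, \<mu>\<^sub>k - 1)\<close> (lemma \<open>intersect_entry_mode\<close>).  Its trace is \<open>\<mu>\<^sub>k\<close> and
  its determinant is \<open>-1\<close>, so its eigenvalues are the values of \<open>f_plus\<close> and \<open>f_minus\<close> at
  \<open>\<mu>\<^sub>k\<close>.

  The waves are \<open>cos + sin\<close> of the same argument (the Hartley transform), because these \<open>n\<close>
  real functions are already pairwise orthogonal, both on the integers and on the half-integers
  (lemma \<open>wave_orthogonal\<close>).  Everything thus stays over the reals, and the
  \<open>2 n\<close> modes form an orthogonal basis.  Multiplicities then come for free: a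
  matrix with an orthogonal basis of eigenvectors is similar to the diagonal matrix of the
  corresponding eigenvalues (lemma \<open>eigenvalues_mset_orthogonal_eigenbasis\<close>).\<close>

section \<open>Spectra from orthogonal eigenbases\<close>

text \<open>The matrix is given by a kernel on the entries of the list, and eigenvectors are
  functions on these entries.  All hypotheses are then sums over a set, so the order of the
  enumeration disappears.  The matrix \<open>P\<close> with the eigenvectors as columns has as its inverse its
  transpose with rows divided by the squared norms, and it conjugates the
  given matrix to a diagonal one.\<close>

lemma eigenvalues_mset_orthogonal_eigenbasis:
  fixes K :: "'a \<Rightarrow> 'a \<Rightarrow> real" and v :: "'b \<Rightarrow> 'a \<Rightarrow> real" and ev :: "'b \<Rightarrow> real"
  assumes "distinct xs" and "finite Y" and card: "card Y = length xs"
    and eigen: "\<And>y x. y \<in> Y \<Longrightarrow> x \<in> set xs \<Longrightarrow> (\<Sum>z\<in>set xs. K x z * v y z) = ev y * v y x"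
    and orth: "\<And>y y'. y \<in> Y \<Longrightarrow> y' \<in> Y \<Longrightarrow> y \<noteq> y' \<Longrightarrow> (\<Sum>z\<in>set xs. v y z * v y' z) = 0"
    and nonzero: "\<And>y. y \<in> Y \<Longrightarrow> (\<Sum>z\<in>set xs. v y z * v y z) \<noteq> 0"
  shows "eigenvalues_mset (mat (length xs) (length xs) (\<lambda>(i, j). K (xs ! i) (xs ! j))) =
    image_mset ev (mset_set Y)"
proof -
  obtain ys where ys: "set ys = Y" "distinct ys"
    using finite_distinct_list[OF \<open>finite Y\<close>] by blast
  define m where "m = length xs"
  have len: "length ys = m"
    using distinct_card[OF ys(2)] ys(1) card by (simp add: m_def)
  have nth_Y: "ys ! i \<in> Y" if "i < m" for i
    using that ys(1) len nth_mem by blast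
  have reindex: "(\<Sum>i = 0..<m. g (xs ! i)) = (\<Sum>z\<in>set xs. g z)" for g :: "'a \<Rightarrow> real"
    using sum.reindex_bij_betw[OF bij_betw_nth[OF \<open>distinct xs\<close> refl refl], of g]
    by (simp add: m_def lessThan_atLeast0)
  define A where "A = mat m m (\<lambda>(i, j). K (xs ! i) (xs ! j))"
  define P where "P = mat m m (\<lambda>(i, c). v (ys ! c) (xs ! i))"
  define Q where
    "Q = mat m m (\<lambda>(c, i). v (ys ! c) (xs ! i) / (\<Sum>z\<in>set xs. v (ys ! c) z * v (ys ! c) z))"
  define D where "D = mat_diag m (\<lambda>c. ev (ys ! c))"
  have carr: "A \<in> carrier_mat m m" "P \<in> carrier_mat m m" "Q \<in> carrier_mat m m"
    "D \<in> carrier_mat m m"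
    by (simp_all add: A_def P_def Q_def D_def)
  have "Q * P = 1\<^sub>m m"
  proof (rule eq_matI)
    fix c d assume "c < dim_row (1\<^sub>m m)" and "d < dim_col (1\<^sub>m m)"
    then have cd: "c < m" "d < m" by auto
    let ?N = "\<Sum>z\<in>set xs. v (ys ! c) z * v (ys ! c) z"
    have "(Q * P) $$ (c, d) = (\<Sum>i = 0..<m. v (ys ! c) (xs ! i) / ?N * v (ys ! d) (xs ! i))"
      using cd by (simp add: Q_def P_def scalar_prod_def)
    also have "\<dots> = (\<Sum>z\<in>set xs. v (ys ! c) z * v (ys ! d) z) / ?N"
      by (subst reindex) (simp add: sum_divide_distrib)
    also have "\<dots> = 1\<^sub>m m $$ (c, d)"
      using cd orth[OF nth_Y nth_Y, of c d] nonzero[OF nth_Y, of c] ys(2) len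
      by (auto simp: nth_eq_iff_index_eq)
    finally show "(Q * P) $$ (c, d) = 1\<^sub>m m $$ (c, d)" .
  qed (use carr in auto)
  then have PQ: "P * Q = 1\<^sub>m m"
    using mat_mult_left_right_inverse carr by blast
  have "A * P = P * D"
  proof (rule eq_matI)
    fix i c assume "i < dim_row (P * D)" and "c < dim_col (P * D)"
    then have ic: "i < m" "c < m" by (auto simp: P_def D_def mat_diag_def)
    have "(A * P) $$ (i, c) = (\<Sum>j = 0..<m. K (xs ! i) (xs ! j) * v (ys ! c) (xs ! j))"
      using ic by (simp add: A_def P_def scalar_prod_def)
    also have "\<dots> = ev (ys ! c) * v (ys ! c) (xs ! i)"
      using ic by (subst reindex) (rule eigen, auto simp: nth_Y m_def)
    also have "\<dots> = (P * D) $$ (i, c)"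
      unfolding D_def using ic by (subst mat_diag_mult_right[OF carr(2)]) (simp add: P_def)
    finally show "(A * P) $$ (i, c) = (P * D) $$ (i, c)" .
  qed (use carr in auto)
  then have "A = P * D * Q"
    using assoc_mult_mat[OF carr(1,2,3)] PQ carr(1) by simp
  then have "similar_mat A D"
    using similar_matI[of A D P Q m] carr PQ \<open>Q * P = 1\<^sub>m m\<close> by simp
  then have "char_poly A = char_poly D"
    by (rule char_poly_similar)
  also have "\<dots> = (\<Prod>a\<leftarrow>diag_mat D. [:- a, 1:])"
    by (rule char_poly_upper_triangular[OF carr(4)]) (auto simp: D_def mat_diag_def)
  also have "diag_mat D = map ev ys"
    by (rule nth_equalityI) (auto simp: diag_mat_def D_def mat_diag_def len)
  finally have char: "char_poly A = (\<Prod>a\<leftarrow>map ev ys. [:- a, 1:])" .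
  have split: "proots (\<Prod>a\<leftarrow>as. [:- a, 1:]) = mset as" for as :: "real list"
  proof (induct as)
    case (Cons a as)
    have "(\<Prod>a\<leftarrow>as. [:- a, 1:]) \<noteq> 0"
      by (auto simp: prod_list_zero_iff)
    then have "proots ([:- a, 1:] * (\<Prod>a\<leftarrow>as. [:- a, 1:])) = {#a#} + mset as"
      by (subst proots_mult) (simp_all add: Cons del: mult_pCons_left)
    then show ?case
      by (simp del: mult_pCons_left)
  qed simp
  have "eigenvalues_mset A = mset (map ev ys)"
    unfolding eigenvalues_mset_def char by (rule split)
  also have "mset ys = mset_set Y"
    using ys mset_set_set by metis
  then have "mset (map ev ys) = image_mset ev (mset_set Y)"
    by simp
  finally show ?thesis
    by (simp add: A_def m_def)
qed

section \<open>The discrete Hartley basis\<close>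

text \<open>The real variable \<open>x\<close> is a position on a circle of circumference \<open>n\<close>; half-integers are
  edge midpoints.  At integers this is the kernel of the discrete Hartley transform.\<close>

definition wave :: "nat \<Rightarrow> nat \<Rightarrow> real \<Rightarrow> real" where
  "wave n k x = cos (2 * pi * real k * x / real n) + sin (2 * pi * real k * x / real n)"

lemma wave_periodic:
  assumes "n > 0"
  shows "wave n k (x + real n) = wave n k x"
proof -
  have "2 * pi * real k * (x + real n) / real n =
      2 * pi * real k * x / real n + 2 * pi * real k"
    using assms by (simp add: field_simps)
  moreover have "cos (y + 2 * pi * real k) = cos y" "sin (y + 2 * pi * real k) = sin y" for y
    using sin_cos_eq_iff[of "y + 2 * pi * real k" y]
    by (metis of_int_of_nat_eq mult.assoc)+
  ultimately show ?thesis
    by (simp add: wave_def)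
qed

text \<open>A wave is a combination of \<open>cos (t x)\<close> and \<open>sin (t x)\<close>; both are eigenfunctions of averaging
  over the two points at distance \<open>d\<close>.\<close>

lemma wave_add_wave:
  "wave n k (x - d) + wave n k (x + d) = 2 * cos (2 * pi * real k * d / real n) * wave n k x"
proof -
  define t where "t = 2 * pi * real k / real n"
  have w: "wave n k y = cos (t * y) + sin (t * y)" for y
    by (simp add: wave_def t_def)
  show ?thesis
    unfolding w right_diff_distrib distrib_left cos_add cos_diff sin_add sin_diff
    by (simp add: t_def algebra_simps)
qed

text \<open>Multiplied by \<open>2 sin (\<pi> m / n)\<close>, which is nonzero unless \<open>n\<close> divides \<open>m\<close>, the sum telescopes,
  and the two boundary terms agree by periodicity.  The phase \<open>a\<close> is arbitrary so that the lemma
  also covers cosines and shifted sample points.\<close>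

lemma sum_sin_roots_of_unity:
  fixes m :: int
  assumes "n > 0" and "\<not> int n dvd m"
  shows "(\<Sum>j = 1..n. sin (2 * pi * of_int m * real j / real n + a)) = 0"
proof -
  define t where "t = pi * of_int m / real n"
  define F where "F j = cos (t * (2 * real j + 1) + a)" for j :: nat
  have tel: "2 * sin t * sin (2 * pi * of_int m * real (Suc j) / real n + a) = F j - F (Suc j)" for j
  proof -
    \<comment> \<open>product to sum: \<open>t\<close> is half the step of the arithmetic progression\<close>
    have "2 * pi * of_int m * real (Suc j) / real n = 2 * t * real (Suc j)"
      by (simp add: t_def)
    moreover have "t - (2 * t * real (Suc j) + a) = - (t * (2 * real j + 1) + a)"
      "t + (2 * t * real (Suc j) + a) = t * (2 * real (Suc j) + 1) + a"
      by (simp_all add: algebra_simps)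
    ultimately show ?thesis
      using sin_times_sin[of t "2 * t * real (Suc j) + a"]
      by (simp only: F_def cos_minus) simp
  qed
  have "2 * sin t * (\<Sum>j = 1..n. sin (2 * pi * of_int m * real j / real n + a)) =
      (\<Sum>j<n. F j - F (Suc j))"
    unfolding sum_distrib_left
    by (simp only: One_nat_def sum.atLeast1_atMost_eq tel)
  also have "\<dots> = F 0 - F n"
    by (rule sum_lessThan_telescope')
  also have "F n = F 0"
  proof -
    have "t * (2 * real n + 1) + a = (t + a) + 2 * pi * of_int m"
      using assms(1) by (simp add: t_def field_simps)
    moreover have "cos (y + 2 * pi * of_int m) = cos y" for y
      using sin_cos_eq_iff by blast
    ultimately have "F n = cos (t + a)"
      by (simp only: F_def)
    then show ?thesis
      by (simp add: F_def)
  qed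
  finally have "sin t * (\<Sum>j = 1..n. sin (2 * pi * of_int m * real j / real n + a)) = 0"
    by simp
  moreover have "sin t \<noteq> 0"
  proof
    assume "sin t = 0"
    then obtain i :: int where "t = of_int i * pi"
      using sin_zero_iff_int2 by blast
    then have "of_int m = (of_int (i * int n) :: real)"
      using assms(1) by (simp add: t_def field_simps)
    then have "m = i * int n"
      by (simp only: of_int_eq_iff)
    with assms(2) show False
      by simp
  qed
  ultimately show ?thesis
    by simp
qed

text \<open>The product of two waves is \<open>cos\<close> of the difference plus \<open>sin\<close> of the sum of their
  arguments.  The sine part has total zero at every frequency: when \<open>n\<close> divides \<open>k + l\<close>, each of its
  terms vanishes, because the argument is a multiple of \<open>\<pi>\<close>; this is where it matters that the
  sample points are integers or half-integers.  The cosine part survives only if \<open>n\<close> divides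
  \<open>k - l\<close>, that is, if \<open>k = l\<close>.\<close>

lemma wave_orthogonal:
  assumes "k \<in> {1..n}" and "l \<in> {1..n}" and "d = 0 \<or> d = 1 / 2"
  shows "(\<Sum>j = 1..n. wave n k (real j + d) * wave n l (real j + d)) = (if k = l then real n else 0)"
proof -
  have n: "n > 0"
    using assms(1) by simp
  define p where "p = int k - int l"
  define q where "q = int k + int l"
  have prod: "wave n k x * wave n l x =
      cos (2 * pi * of_int p * x / real n) + sin (2 * pi * of_int q * x / real n)" for x
  proof -
    have angles: "2 * pi * of_int p * x / real n = 2 * pi * real k * x / real n - 2 * pi * real l * x / real n"
      "2 * pi * of_int q * x / real n = 2 * pi * real k * x / real n + 2 * pi * real l * x / real n"
      by (simp_all add: p_def q_def algebra_simps diff_divide_distrib add_divide_distrib)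
    show ?thesis
      unfolding wave_def angles cos_diff sin_add by (simp only: algebra_simps)
  qed
  have cos_sum: "(\<Sum>j = 1..n. cos (2 * pi * of_int p * (real j + d) / real n)) =
      (if k = l then real n else 0)"
  proof (cases "k = l")
    case True
    then show ?thesis by (simp add: p_def)
  next
    case False
    have "\<bar>p\<bar> < int n" "p \<noteq> 0"
      using assms(1,2) False by (auto simp: p_def)
    then have "\<not> int n dvd p"
      using zdvd_not_zless[of "\<bar>p\<bar>" "int n"] by simp
    moreover have "cos (2 * pi * of_int p * (real j + d) / real n) =
        sin (2 * pi * of_int p * real j / real n + (2 * pi * of_int p * d / real n + pi / 2))" for j
    proof -
      have "2 * pi * of_int p * (real j + d) / real n =
          2 * pi * of_int p * real j / real n + 2 * pi * of_int p * d / real n"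
        by (simp add: algebra_simps add_divide_distrib)
      moreover have "cos y = sin (y + pi / 2)" for y :: real
        by (simp add: sin_add)
      ultimately show ?thesis
        by (simp only: add.assoc)
    qed
    ultimately show ?thesis
      using sum_sin_roots_of_unity[OF n] False by simp
  qed
  have sin_sum: "(\<Sum>j = 1..n. sin (2 * pi * of_int q * (real j + d) / real n)) = 0"
  proof (cases "int n dvd q")
    case True
    then obtain r where r: "q = int n * r" by blast
    have "sin (2 * pi * of_int q * (real j + d) / real n) = 0" for j
    proof -
      \<comment> \<open>\<open>2 * d\<close> is the integer 0 or 1; the floor gives it as an \<open>int\<close>\<close>
      have "2 * pi * of_int q * (real j + d) / real n = of_int (r * (2 * int j + \<lfloor>2 * d\<rfloor>)) * pi"
        using n assms(3) by (auto simp: r field_simps)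
      then show ?thesis
        using sin_zero_iff_int2 by blast
    qed
    then show ?thesis by simp
  next
    case False
    have "2 * pi * of_int q * (real j + d) / real n =
        2 * pi * of_int q * real j / real n + 2 * pi * of_int q * d / real n" for j
      by (simp add: algebra_simps add_divide_distrib)
    then show ?thesis
      using sum_sin_roots_of_unity[OF n False] by simp
  qed
  show ?thesis
    by (simp only: prod sum.distrib cos_sum sin_sum add_0_right)
qed

section \<open>Incidences in the circular graph\<close>

definition succ_mod :: "nat \<Rightarrow> nat \<Rightarrow> nat" where
  "succ_mod n i = (if i = n then 1 else i + 1)"

definition pred_mod :: "nat \<Rightarrow> nat \<Rightarrow> nat" where
  "pred_mod n i = (if i = 1 then n else i - 1)"

text \<open>Labels for the simplices that remember the position of an edge: \<open>Inl i\<close> is the vertex \<open>i\<close>,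
  \<open>Inr i\<close> the edge leaving \<open>i\<close> in cyclic direction.\<close>

fun cell :: "nat \<Rightarrow> nat + nat \<Rightarrow> nat set" where
  "cell n (Inl i) = {i}"
| "cell n (Inr i) = {i, succ_mod n i}"

text \<open>For \<open>n = 2\<close> the two edges would be the same set of vertices, and for \<open>n = 1\<close> the edge would be
  the vertex.\<close>

lemma bij_betw_cell:
  assumes "n \<ge> 3"
  shows "bij_betw (cell n) ({1..n} <+> {1..n}) (circular_graph n)"
proof (rule bij_betw_imageI)
  show "inj_on (cell n) ({1..n} <+> {1..n})"
    using assms
    by (auto simp: inj_on_def succ_mod_def doubleton_eq_iff singleton_insert_inj_eq split: if_splits)
  show "cell n ` ({1..n} <+> {1..n}) = circular_graph n"
  proof -
    have "{1..n} = insert n {1..<n}"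
      using assms by auto
    moreover have "cell n ` Inr ` {1..<n} = {{i, i + 1} | i. i \<in> {1..<n}}"
      by (fastforce simp: succ_mod_def image_image)
    ultimately have "cell n ` Inr ` {1..n} = {{i, i + 1} | i. i \<in> {1..<n}} \<union> {{n, 1}}"
      by (auto simp: succ_mod_def)
    moreover have "cell n ` Inl ` {1..n} = {{i} | i. i \<in> {1..n}}"
      unfolding image_image by auto
    ultimately show ?thesis
      by (simp only: circular_graph_def Plus_def image_Un Un_assoc)
  qed
qed

lemma pred_succ_mod_ranges:
  assumes "n \<ge> 3" and "i \<in> {1..n}"
  shows "succ_mod n i \<in> {1..n}" "pred_mod n i \<in> {1..n}"
    "i \<noteq> pred_mod n i" "i \<noteq> succ_mod n i" "succ_mod n i \<noteq> pred_mod n i"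
  using assms by (auto simp: succ_mod_def pred_mod_def)

lemma succ_mod_eq_iff:
  assumes "n \<ge> 3" and "i \<in> {1..n}" and "j \<in> {1..n}"
  shows "succ_mod n j = i \<longleftrightarrow> j = pred_mod n i"
  using assms by (auto simp: succ_mod_def pred_mod_def)

lemma wave_succ_mod:
  assumes "n \<ge> 3"
  shows "wave n k (real (succ_mod n i) + d) = wave n k (real i + 1 + d)"
  using wave_periodic[of n k "1 + d"] assms by (auto simp: succ_mod_def add_ac)

lemma wave_pred_mod:
  assumes "n \<ge> 3" and "i \<in> {1..n}"
  shows "wave n k (real (pred_mod n i) + d) = wave n k (real i - 1 + d)"
  using wave_periodic[of n k d] assms by (auto simp: pred_mod_def add_ac of_nat_diff)

definition intersect_entry :: "nat \<Rightarrow> nat + nat \<Rightarrow> nat + nat \<Rightarrow> real" where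
  "intersect_entry n x y = (if cell n x \<inter> cell n y \<noteq> {} then 1 else 0)"

lemma sum_indicator_subset:
  fixes g :: "'a \<Rightarrow> real"
  assumes "finite A" and "\<And>z. z \<in> A \<Longrightarrow> P z \<longleftrightarrow> z \<in> B" and "B \<subseteq> A"
  shows "(\<Sum>z\<in>A. (if P z then 1 else 0) * g z) = sum g B"
proof -
  have "(\<Sum>z\<in>A. (if P z then 1 else 0) * g z) = (\<Sum>z\<in>A. if z \<in> B then g z else 0)"
    by (rule sum.cong) (auto simp: assms(2))
  also have "\<dots> = sum g B"
    using assms(1,3) by (simp add: sum.If_cases Int_absorb1)
  finally show ?thesis .
qed

text \<open>For \<open>n \<ge> 3\<close> the five simplices met by an edge are distinct, so each contributes exactly
  once; for \<open>n = 3\<close> the three edges among them are all the edges.\<close>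

lemma sum_intersect_entry:
  fixes g :: "nat + nat \<Rightarrow> real"
  assumes n: "n \<ge> 3" and i: "i \<in> {1..n}"
  shows "(\<Sum>z\<in>{1..n} <+> {1..n}. intersect_entry n (Inl i) z * g z) =
      g (Inl i) + g (Inr i) + g (Inr (pred_mod n i))"
    and "(\<Sum>z\<in>{1..n} <+> {1..n}. intersect_entry n (Inr i) z * g z) =
      g (Inl i) + g (Inl (succ_mod n i)) +
      g (Inr i) + g (Inr (succ_mod n i)) + g (Inr (pred_mod n i))"
proof -
  note ranges = pred_succ_mod_ranges[OF n i]
  have "(\<Sum>z\<in>{1..n} <+> {1..n}. intersect_entry n (Inl i) z * g z) =
      sum g {Inl i, Inr i, Inr (pred_mod n i)}"
    unfolding intersect_entry_def
  proof (rule sum_indicator_subset)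
    fix z assume "z \<in> {1..n} <+> {1..n}"
    then consider j where "z = Inl j" | j where "z = Inr j" "j \<in> {1..n}"
      by auto
    then show "cell n (Inl i) \<inter> cell n z \<noteq> {} \<longleftrightarrow> z \<in> {Inl i, Inr i, Inr (pred_mod n i)}"
    proof cases
      case 1
      then show ?thesis by auto
    next
      case 2
      have "cell n (Inl i) \<inter> cell n z \<noteq> {} \<longleftrightarrow> j = i \<or> succ_mod n j = i"
        using 2(1) by auto
      then show ?thesis
        unfolding succ_mod_eq_iff[OF n i 2(2)] 2(1) by blast
    qed
  qed (use ranges i in auto)
  then show "(\<Sum>z\<in>{1..n} <+> {1..n}. intersect_entry n (Inl i) z * g z) =
      g (Inl i) + g (Inr i) + g (Inr (pred_mod n i))"
    using ranges by simp
  have inj: "succ_mod n i = succ_mod n j \<longleftrightarrow> i = j" if "j \<in> {1..n}" for j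
    using that i by (auto simp: succ_mod_def split: if_splits)
  have meet: "cell n (Inr i) \<inter> cell n (Inr j) \<noteq> {} \<longleftrightarrow>
      j = i \<or> j = succ_mod n i \<or> j = pred_mod n i" if "j \<in> {1..n}" for j
  proof -
    have "cell n (Inr i) \<inter> cell n (Inr j) \<noteq> {} \<longleftrightarrow>
        j = i \<or> j = succ_mod n i \<or> succ_mod n j = i \<or> succ_mod n i = succ_mod n j"
      by auto
    then show ?thesis
      unfolding succ_mod_eq_iff[OF n i that] inj[OF that] by blast
  qed
  have "(\<Sum>z\<in>{1..n} <+> {1..n}. intersect_entry n (Inr i) z * g z) =
      sum g {Inl i, Inl (succ_mod n i), Inr i, Inr (succ_mod n i), Inr (pred_mod n i)}"
    unfolding intersect_entry_def
  proof (rule sum_indicator_subset)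
    fix z assume "z \<in> {1..n} <+> {1..n}"
    then consider j where "z = Inl j" | j where "z = Inr j" "j \<in> {1..n}"
      by auto
    then show "cell n (Inr i) \<inter> cell n z \<noteq> {} \<longleftrightarrow>
        z \<in> {Inl i, Inl (succ_mod n i), Inr i, Inr (succ_mod n i), Inr (pred_mod n i)}"
    proof cases
      case 1
      then show ?thesis by auto
    next
      case 2
      show ?thesis
        unfolding 2(1) meet[OF 2(2)] by blast
    qed
  qed (use ranges i in auto)
  then show "(\<Sum>z\<in>{1..n} <+> {1..n}. intersect_entry n (Inr i) z * g z) =
      g (Inl i) + g (Inl (succ_mod n i)) +
      g (Inr i) + g (Inr (succ_mod n i)) + g (Inr (pred_mod n i))"
    using ranges by simp
qed

section \<open>Eigenmodes of the connection Laplacian\<close>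

text \<open>A wave sampled at the positions of the simplices, with separate amplitudes for vertices
  and edges.\<close>

fun mode :: "nat \<Rightarrow> nat \<Rightarrow> real \<Rightarrow> real \<Rightarrow> nat + nat \<Rightarrow> real" where
  "mode n k \<alpha> \<beta> (Inl j) = \<alpha> * wave n k (real j)"
| "mode n k \<alpha> \<beta> (Inr j) = \<beta> * wave n k (real j + 1 / 2)"

text \<open>The factor by which a wave is multiplied when it is summed over the two positions at distance
  \<open>1/2\<close>.  It is negative for \<open>k > n / 2\<close> and may vanish; only its square is \<open>\<mu>\<close>.\<close>

definition coupling :: "nat \<Rightarrow> nat \<Rightarrow> real" where
  "coupling n k = 2 * cos (pi * real k / real n)"

lemma coupling_square: "coupling n k * coupling n k = mu n k"
  by (simp add: coupling_def mu_def power2_eq_square)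

text \<open>Two half steps of a wave give \<open>h(y - 1) + 2 h(y) + h(y + 1) = \<mu> h(y)\<close>, whereas the sum over
  an edge and its neighbours counts \<open>h(y)\<close> only once; hence the entry \<open>\<mu> - 1\<close> of the block.\<close>

lemma intersect_entry_mode:
  assumes n: "n \<ge> 3" and x: "x \<in> {1..n} <+> {1..n}"
    and vertex: "\<alpha> + coupling n k * \<beta> = ev * \<alpha>"
    and edge: "coupling n k * \<alpha> + (mu n k - 1) * \<beta> = ev * \<beta>"
  shows "(\<Sum>z\<in>{1..n} <+> {1..n}. intersect_entry n x z * mode n k \<alpha> \<beta> z) = ev * mode n k \<alpha> \<beta> x"
proof -
  have half: "wave n k (y - 1 / 2) + wave n k (y + 1 / 2) = coupling n k * wave n k y" for y
    using wave_add_wave[of n k y "1 / 2"] by (simp add: coupling_def)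
  show ?thesis
  proof (cases x)
    case (Inl i)
    with x have i: "i \<in> {1..n}" by auto
    have "(\<Sum>z\<in>{1..n} <+> {1..n}. intersect_entry n x z * mode n k \<alpha> \<beta> z) =
        \<alpha> * wave n k (real i) + \<beta> * (wave n k (real i - 1 / 2) + wave n k (real i + 1 / 2))"
      unfolding Inl sum_intersect_entry(1)[OF n i]
      by (simp add: wave_pred_mod[OF n i] algebra_simps)
    also have "\<dots> = (\<alpha> + coupling n k * \<beta>) * wave n k (real i)"
      unfolding half by (simp add: algebra_simps)
    finally show ?thesis
      by (simp add: vertex Inl)
  next
    case (Inr i)
    with x have i: "i \<in> {1..n}" by auto
    let ?y = "real i + 1 / 2"
    \<comment> \<open>\<open>?y\<close> is the midpoint of the edge\<close>
    have *: "wave n k (real i) + wave n k (real i + 1) = coupling n k * wave n k ?y"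
      using half[of ?y] by (simp add: add.assoc)
    have "wave n k (?y - 1) + wave n k ?y = coupling n k * wave n k (real i)"
      "wave n k ?y + wave n k (?y + 1) = coupling n k * wave n k (real i + 1)"
      using half[of "real i"] half[of "real i + 1"] by (simp_all add: algebra_simps)
    then have "wave n k (?y - 1) + 2 * wave n k ?y + wave n k (?y + 1) =
        coupling n k * (wave n k (real i) + wave n k (real i + 1))"
      by (simp add: algebra_simps)
    then have **: "wave n k (?y - 1) + wave n k ?y + wave n k (?y + 1) = (mu n k - 1) * wave n k ?y"
      unfolding * by (simp add: algebra_simps flip: coupling_square)
    have "(\<Sum>z\<in>{1..n} <+> {1..n}. intersect_entry n x z * mode n k \<alpha> \<beta> z) =
        \<alpha> * (wave n k (real i) + wave n k (real i + 1)) +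
        \<beta> * (wave n k (?y - 1) + wave n k ?y + wave n k (?y + 1))"
      unfolding Inr sum_intersect_entry(2)[OF n i]
      using wave_succ_mod[OF n, of k i 0]
      by (simp add: wave_pred_mod[OF n i] wave_succ_mod[OF n] algebra_simps)
    also have "\<dots> = (coupling n k * \<alpha> + (mu n k - 1) * \<beta>) * wave n k ?y"
      unfolding * ** by (simp add: algebra_simps)
    finally show ?thesis
      by (simp add: edge Inr)
  qed
qed

lemma mode_inner_product:
  assumes "k \<in> {1..n}" and "l \<in> {1..n}"
  shows "(\<Sum>z\<in>{1..n} <+> {1..n}. mode n k \<alpha> \<beta> z * mode n l \<gamma> \<delta> z) =
    (if k = l then real n * (\<alpha> * \<gamma> + \<beta> * \<delta>) else 0)"
proof -
  have "(\<Sum>z\<in>{1..n} <+> {1..n}. mode n k \<alpha> \<beta> z * mode n l \<gamma> \<delta> z) =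
      \<alpha> * \<gamma> * (\<Sum>j = 1..n. wave n k (real j + 0) * wave n l (real j + 0)) +
      \<beta> * \<delta> * (\<Sum>j = 1..n. wave n k (real j + 1 / 2) * wave n l (real j + 1 / 2))"
    by (simp add: sum.Plus sum_distrib_left mult_ac)
  then show ?thesis
    by (subst (asm) (1 2) wave_orthogonal[OF assms]) (auto simp: algebra_simps)
qed

text \<open>The two numbers are the roots of \<open>t\<^sup>2 - x t - 1\<close>, the characteristic polynomial of the
  block when \<open>x = \<mu>\<close>.\<close>

lemma f_plus_f_minus:
  shows "f_plus x + f_minus x = x" and "f_plus x * f_minus x = - 1" and "f_minus x < 0"
proof -
  show "f_plus x + f_minus x = x"
    by (simp add: f_plus_def f_minus_def add_divide_distrib diff_divide_distrib)
  have "f_plus x * f_minus x = (x\<^sup>2 - (sqrt (x\<^sup>2 + 4))\<^sup>2) / 4"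
    by (simp add: f_plus_def f_minus_def power2_eq_square algebra_simps)
  also have "(sqrt (x\<^sup>2 + 4))\<^sup>2 = x\<^sup>2 + 4"
    by (simp add: add_nonneg_nonneg)
  finally show "f_plus x * f_minus x = - 1"
    by simp
  have "\<bar>x\<bar> < sqrt (x\<^sup>2 + 4)"
    by (rule real_less_rsqrt) simp
  then show "f_minus x < 0"
    by (simp add: f_minus_def)
qed

text \<open>Write \<open>b\<close> for the coupling and \<open>t = f_minus \<mu>\<close>.  The first row of the block gives the
  eigenvector \<open>(b, t - 1)\<close> for \<open>t\<close>; the other eigenvector of a symmetric block is orthogonal to
  it, hence \<open>(1 - t, b)\<close>.  As \<open>t < 0\<close>, neither is zero, even if \<open>b = 0\<close>.  The analogous choice
  \<open>(b, f_plus \<mu> - 1)\<close> would be zero if \<open>b = 0\<close>.\<close>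

fun eigenmode :: "nat \<Rightarrow> nat + nat \<Rightarrow> nat + nat \<Rightarrow> real" where
  "eigenmode n (Inl k) = mode n k (1 - f_minus (mu n k)) (coupling n k)"
| "eigenmode n (Inr k) = mode n k (coupling n k) (f_minus (mu n k) - 1)"

fun mode_eigenvalue :: "nat \<Rightarrow> nat + nat \<Rightarrow> real" where
  "mode_eigenvalue n (Inl k) = f_plus (mu n k)"
| "mode_eigenvalue n (Inr k) = f_minus (mu n k)"

lemma eigenmode_eigen:
  assumes n: "n \<ge> 3" and x: "x \<in> {1..n} <+> {1..n}"
  shows "(\<Sum>z\<in>{1..n} <+> {1..n}. intersect_entry n x z * eigenmode n y z) =
    mode_eigenvalue n y * eigenmode n y x"
proof (cases y)
  case (Inl k)
  define b where "b = coupling n k"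
  define p where "p = f_plus (mu n k)"
  define m where "m = f_minus (mu n k)"
  have facts: "b * b = mu n k" "p = mu n k - m" "p * m = - 1"
    using f_plus_f_minus[of "mu n k"] by (simp_all add: b_def p_def m_def coupling_square)
  have "1 - m + b * b = p * (1 - m)"
    using facts by (simp add: algebra_simps)
  moreover have "b * (1 - m) + (mu n k - 1) * b = p * b"
    unfolding facts(2) by (simp add: algebra_simps)
  ultimately show ?thesis
    unfolding Inl eigenmode.simps mode_eigenvalue.simps
    by (intro intersect_entry_mode[OF n x]) (simp_all add: b_def p_def m_def)
next
  case (Inr k)
  define b where "b = coupling n k"
  define p where "p = f_plus (mu n k)"
  define m where "m = f_minus (mu n k)"
  have facts: "b * b = mu n k" "mu n k = p + m" "p * m = - 1"
    using f_plus_f_minus[of "mu n k"] by (simp_all add: b_def p_def m_def coupling_square)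
  have "b + b * (m - 1) = m * b"
    by (simp add: algebra_simps)
  moreover have "b * b + (mu n k - 1) * (m - 1) = m * (m - 1)"
    using facts by (simp add: algebra_simps)
  ultimately show ?thesis
    unfolding Inr eigenmode.simps mode_eigenvalue.simps
    by (intro intersect_entry_mode[OF n x]) (simp_all add: b_def p_def m_def)
qed

lemma eigenmode_orthogonal:
  assumes "y \<in> {1..n} <+> {1..n}" and "y' \<in> {1..n} <+> {1..n}" and "y \<noteq> y'"
  shows "(\<Sum>z\<in>{1..n} <+> {1..n}. eigenmode n y z * eigenmode n y' z) = 0"
proof -
  from assms show ?thesis
    by (elim PlusE)
      (simp_all only: eigenmode.simps mode_inner_product, simp_all add: algebra_simps)
qed

lemma eigenmode_norm_nonzero:
  assumes "y \<in> {1..n} <+> {1..n}"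
  shows "(\<Sum>z\<in>{1..n} <+> {1..n}. eigenmode n y z * eigenmode n y z) \<noteq> 0"
proof -
  have "1 - f_minus x \<noteq> 0" "f_minus x - 1 \<noteq> 0" for x
    using f_plus_f_minus(3)[of x] by simp_all
  then show ?thesis
    using assms
    by (elim PlusE)
      (auto simp only: eigenmode.simps mode_inner_product, auto simp: sum_squares_eq_zero_iff)
qed

theorem lemma1:
  fixes n :: nat and xs :: "nat set list"
  assumes "n \<ge> 3"
    and "distinct xs" and "set xs = circular_graph n"
  shows "connection_Laplacian xs \<in> carrier_mat (2 * n) (2 * n) \<and>
    eigenvalues_mset (connection_Laplacian xs) =
      {# f_plus (mu n k). k \<in># mset_set {1..n} #} +
      {# f_minus (mu n k). k \<in># mset_set {1..n} #}"
proof -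
  let ?C = "{1..n} <+> {1..n}"
  \<comment> \<open>relabel the simplices, so that eigenvectors are functions of the labels\<close>
  define ws where "ws = map (inv_into ?C (cell n)) xs"
  note bij = bij_betw_cell[OF assms(1)]
  have xs: "xs = map (cell n) ws"
    unfolding ws_def map_map
    by (rule map_idI[symmetric]) (simp add: bij_betw_inv_into_right[OF bij] assms(3) del: One_nat_def)
  have set_ws: "set ws = ?C"
    using bij_betw_imp_surj_on[OF bij_betw_inv_into[OF bij]] assms(3) by (simp add: ws_def)
  have ws: "distinct ws"
    using assms(2) xs by (simp add: distinct_map)
  have card: "card ?C = length ws"
    using distinct_card[OF ws] set_ws by simp
  have "length xs = card ?C"
    by (simp only: card xs length_map)
  then have len: "length xs = 2 * n"
    by (simp add: card_Plus)
  have L: "connection_Laplacian xs =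
      mat (length ws) (length ws) (\<lambda>(i, j). intersect_entry n (ws ! i) (ws ! j))"
    by (rule eq_matI) (auto simp: connection_Laplacian_def intersect_entry_def xs)
  have "eigenvalues_mset (connection_Laplacian xs) = image_mset (mode_eigenvalue n) (mset_set ?C)"
    unfolding L
    by (rule eigenvalues_mset_orthogonal_eigenbasis[where v = "eigenmode n", OF ws _ card])
      (simp_all only: set_ws finite_Plus finite_atLeastAtMost eigenmode_eigen[OF assms(1)]
        eigenmode_orthogonal eigenmode_norm_nonzero not_False_eq_True)
  also have "mset_set ?C = image_mset Inl (mset_set {1..n}) + image_mset Inr (mset_set {1..n})"
    unfolding Plus_def
    by (subst mset_set_Union) (auto simp: image_mset_mset_set)
  finally show ?thesis
    using len by (simp add: connection_Laplacian_def image_mset.compositionality comp_def)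
qed

end
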